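(* Let $T \in \mathbb{R}^{n_1 \times \dots \times n_s}$, let $P$ be a unit domain of $s$-tuples, and let $r$ be a nonnegative integer. Then there is a tensor $\widehat{T}$ that is a linear combination of $r$ rank one tensors of the form $u^1 \otimes \dots \otimes u^s$ with $(u^1,\dots,u^s) \in P$, satisfying $$\|T - \widehat{T}\|_P \le \frac{\|\varsigma^{(r+1)}\|_2}{\sqrt{r+1}} \le \frac{\|T\|_F}{\sqrt{r+1}},$$ where $\varsigma^{(r+1)} = (\sigma_1,\dots,\sigma_{r+1})$ are the first $r+1$ projection values of $T$ with respect to $P$.
   Context: A unit domain is a set $P \subseteq \{(x_1,\dots,x_s) \in \mathbb{R}^{n_1}\times\dots\times\mathbb{R}^{n_s} : \|x_1\|_2 = \dots = \|x_s\|_2 = 1\}$. For a tensor $T$, $\|T\|_F = \big(\sum_{i_1,\dots,i_s} T_{i_1\dots i_s}^2\big)^{1/2}$ (associated with the entrywise inner product of tensors), and the $s$-form is $T(x^1,\dots,x^s) = \sum_{i_1,\dots,i_s} T_{i_1\dots i_s} x^1_{i_1}\cdots x^s_{i_s}$. The $P$-norm is $\|T\|_P = \max_{(u^1,\dots,u^s)\in P} |T(u^1,\dots,u^s)|$. For $Q \subseteq P$, $\mathrm{Proj}_Q(T)$ is the orthogonal projection (in the entrywise inner product) of $T$ onto $\mathrm{span}\{u^1\otimes\dots\otimes u^s : (u^1,\dots,u^s)\in Q\}$. Greedy ordering: $P^{(0)}=\emptyset$; given $P^{(j)}$, the next element $p_{j+1} \in P$ maximizes $\big(\mathrm{Proj}_{P^{(j)}\cup\{p_{j+1}\}}(T)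 - \mathrm{Proj}_{P^{(j)}}(T)\big)(p_{j+1})$ (the $s$-form evaluated at the tuple $p_{j+1}$; ties broken arbitrarily, maxima assumed attained), and $P^{(j+1)} = P^{(j)}\cup\{p_{j+1}\}$. The projection values are $\sigma_j = \|\mathrm{Proj}_{P^{(j)}}(T) - \mathrm{Proj}_{P^{(j-1)}}(T)\|_F$ for $j\ge 1$.
   Formalization: In the greedy ordering, the next element maximizes the absolute value of the projection increment evaluated at it, not the signed value; with signed values the first inequality fails, e.g. for s=1, P={e1,e2}, T=-10e1-e2, r=0. *)

theory Defs
  imports "HOL-Analysis.Analysis"
begin

text \<open>
  The modes of a tensor are indexed by the finite type \<open>'s\<close>.  To allow a different dimension in
  each mode, all coordinates are taken from one finite type \<open>'i\<close>, and mode \<open>k\<close> uses only the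
  coordinates in \<open>I k\<close>, so its dimension is \<open>card (I k)\<close>; entries outside are zero.
  The inner product and norm of \<open>real ^ ('s \<Rightarrow> 'i)\<close> are then the entrywise inner product and
  the Frobenius norm.
\<close>

type_synonym ('s, 'i) tensor = "real ^ ('s \<Rightarrow> 'i)"

definition coord_space :: "'i::finite set \<Rightarrow> (real ^ 'i) set" where
  "coord_space A = {x. \<forall>a. a \<notin> A \<longrightarrow> x $ a = 0}"

definition tensor_space :: "('s::finite \<Rightarrow> 'i::finite set) \<Rightarrow> ('s, 'i) tensor set" where
  "tensor_space I = {T. \<forall>i. (\<exists>k. i k \<notin> I k) \<longrightarrow> T $ i = 0}"

definition unit_domain :: "('s::finite \<Rightarrow> 'i::finite set) \<Rightarrow> ('s \<Rightarrow> real ^ 'i) set \<Rightarrow> bool" where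
  "unit_domain I P \<longleftrightarrow> (\<forall>u\<in>P. \<forall>k. u k \<in> coord_space (I k) \<and> norm (u k) = 1)"

definition rank_one :: "('s::finite \<Rightarrow> real ^ 'i::finite) \<Rightarrow> ('s, 'i) tensor" where
  "rank_one u = (\<chi> i. \<Prod>k\<in>UNIV. u k $ i k)"

definition form :: "('s::finite, 'i::finite) tensor \<Rightarrow> ('s \<Rightarrow> real ^ 'i) \<Rightarrow> real" where
  "form T u = (\<Sum>i\<in>UNIV. T $ i * (\<Prod>k\<in>UNIV. u k $ i k))"

text \<open>
  The maximum is written as a supremum.  For a nonempty unit domain the values are bounded, so
  this is the maximum whenever that is attained.
\<close>

definition P_norm :: "('s::finite \<Rightarrow> real ^ 'i::finite) set \<Rightarrow> ('s, 'i) tensor \<Rightarrow> real" where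
  "P_norm P T = (SUP u\<in>P. \<bar>form T u\<bar>)"

definition orth_proj :: "'a::euclidean_space set \<Rightarrow> 'a \<Rightarrow> 'a" where
  "orth_proj V x = (THE y. y \<in> V \<and> (\<forall>v\<in>V. orthogonal (x - y) v))"

lemma orth_proj_ex1:
  fixes V :: "'a::euclidean_space set"
  assumes "subspace V"
  shows "\<exists>!y. y \<in> V \<and> (\<forall>v\<in>V. orthogonal (x - y) v)"
proof -
  have V: "span V = V" using assms by simp
  obtain y z where y: "y \<in> V" "\<And>w. w \<in> V \<Longrightarrow> orthogonal z w" "x = y + z"
    using orthogonal_subspace_decomp_exists[of V x] unfolding V by blast
  show ?thesis
  proof (rule ex1I[of _ y])
    show "y \<in> V \<and> (\<forall>v\<in>V. orthogonal (x - y) v)" using y by simp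
    fix y' assume y': "y' \<in> V \<and> (\<forall>v\<in>V. orthogonal (x - y') v)"
    have "y' - y \<in> V" using y(1) y' assms by (simp add: subspace_diff)
    then have "(y' - y) \<bullet> (y' - y) = 0"
      using y y' by (auto simp: orthogonal_def inner_diff_left inner_diff_right inner_add_left)
    then show "y' = y" by simp
  qed
qed

definition Proj :: "('s::finite \<Rightarrow> real ^ 'i::finite) set \<Rightarrow> ('s, 'i) tensor \<Rightarrow> ('s, 'i) tensor" where
  "Proj Q T = orth_proj (span (rank_one ` Q)) T"

text \<open>
  The sequence \<open>p 1, \<dots>, p m\<close> is an initial part of a greedy ordering.  Its existence contains the
  assumption that the maxima are attained; \<open>p 0\<close> is not used.

  The increment is maximized in absolute value, matching the absolute value in \<open>P_norm\<close>.  If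
  every \<open>u\<close> in \<open>P\<close> can be replaced by one with the opposite rank one tensor, this is the same as
  maximizing the signed value.  For other unit domains the signed choice does not control \<open>P_norm\<close>:
  with one mode, \<open>P = {e1, e2}\<close> and \<open>T = - 10 e1 - e2\<close> it picks \<open>e2\<close> first, with first projection
  value 1, while the norm of \<open>T\<close> is 10.
\<close>

definition greedy_ordering ::
  "('s::finite, 'i::finite) tensor \<Rightarrow> ('s \<Rightarrow> real ^ 'i) set \<Rightarrow> (nat \<Rightarrow> 's \<Rightarrow> real ^ 'i) \<Rightarrow> nat \<Rightarrow> bool"
  where
  "greedy_ordering T P p m \<longleftrightarrow>
     (\<forall>j<m. is_arg_max (\<lambda>q. \<bar>form (Proj (insert q (p ` {1..j})) T - Proj (p ` {1..j}) T) q\<bar>)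
              (\<lambda>q. q \<in> P) (p (j + 1)))"

definition proj_value ::
  "('s::finite, 'i::finite) tensor \<Rightarrow> (nat \<Rightarrow> 's \<Rightarrow> real ^ 'i) \<Rightarrow> nat \<Rightarrow> real" where
  "proj_value T p j = norm (Proj (p ` {1..j}) T - Proj (p ` {1..j - 1}) T)"

end

theory Submission
  imports Defs
begin

text \<open>
  Since \<open>q\<close> lies in the span of every set containing it, the greedy increment at \<open>q\<close> is the value
  at \<open>q\<close> of the current residual.  Hence the \<open>P\<close>-norm of the residual after \<open>j\<close> steps is attained
  at the next greedy element, where Cauchy--Schwarz bounds it by \<open>\<sigma>\<^bsub>j+1\<^esub>\<close>.  By Pythagoras the
  squares of the projection values sum to at most \<open>\<parallel>T\<parallel>\<^sup>2\<close>, and the smallest of the first \<open>r + 1\<close> of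
  them is at most their quadratic mean; stopping just before that step needs at most \<open>r\<close> terms.
\<close>

lemma orth_proj_mem:
  fixes V :: "'a::euclidean_space set"
  assumes "subspace V"
  shows "orth_proj V x \<in> V"
  using theI'[OF orth_proj_ex1[OF assms, of x]] by (simp add: orth_proj_def)

lemma inner_orth_proj:
  fixes V :: "'a::euclidean_space set"
  assumes "subspace V" "v \<in> V"
  shows "orth_proj V x \<bullet> v = x \<bullet> v"
  using theI'[OF orth_proj_ex1[OF assms(1), of x]] assms(2)
  by (simp add: orth_proj_def orthogonal_def inner_diff_left)

text \<open>Pythagoras for nested subspaces: the smaller projection lies in both \<open>V\<close>
  and \<open>W\<close>, so both projections of \<open>x\<close> have the same inner product with
  it.\<close>

lemma norm_orth_proj_diff:
  fixes V W :: "'a::euclidean_space set"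
  assumes "subspace V" "subspace W" "V \<subseteq> W"
  shows "(norm (orth_proj W x - orth_proj V x))\<^sup>2 = (norm (orth_proj W x))\<^sup>2 - (norm (orth_proj V x))\<^sup>2"
proof -
  have "orth_proj V x \<in> V" "orth_proj V x \<in> W"
    using orth_proj_mem[OF assms(1)] assms(3) by auto
  then have "orth_proj W x \<bullet> orth_proj V x = orth_proj V x \<bullet> orth_proj V x"
    using inner_orth_proj[OF assms(1)] inner_orth_proj[OF assms(2)] by metis
  then show ?thesis
    by (simp add: power2_norm_eq_inner inner_diff_left inner_diff_right inner_commute)
qed

lemma norm_orth_proj_le:
  fixes V :: "'a::euclidean_space set"
  assumes "subspace V"
  shows "norm (orth_proj V x) \<le> norm x"
proof -
  have "(norm (orth_proj V x))\<^sup>2 = x \<bullet> orth_proj V x"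
    using inner_orth_proj[OF assms orth_proj_mem[OF assms]] by (simp add: power2_norm_eq_inner)
  also have "\<dots> \<le> norm x * norm (orth_proj V x)"
    by (rule norm_cauchy_schwarz)
  finally show ?thesis
    by (cases "orth_proj V x = 0") (simp_all add: power2_eq_square)
qed

text \<open>Indexing by \<open>j<n\<close> rather than by elements of the image gives exactly
  \<open>n\<close> summands even when \<open>f\<close> repeats values. The combinations form a
  subspace containing every \<open>f k\<close>.\<close>

lemma span_image_lessThan:
  fixes f :: "nat \<Rightarrow> 'a::real_vector"
  assumes "y \<in> span (f ` {..<n})"
  obtains c where "y = (\<Sum>j<n. c j *\<^sub>R f j)"
proof -
  let ?S = "range (\<lambda>c. \<Sum>j<n. c j *\<^sub>R f j)"
  have "subspace ?S"
    unfolding subspace_def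
  proof (intro conjI ballI allI)
    show "0 \<in> ?S" by (rule range_eqI[of _ _ "\<lambda>_. 0"]) simp
    fix x y a assume "x \<in> ?S"
    then obtain c where c: "x = (\<Sum>j<n. c j *\<^sub>R f j)" by blast
    show "a *\<^sub>R x \<in> ?S"
      by (rule range_eqI[of _ _ "\<lambda>j. a * c j"]) (simp add: c scaleR_sum_right)
    assume "y \<in> ?S"
    then obtain d where d: "y = (\<Sum>j<n. d j *\<^sub>R f j)" by blast
    show "x + y \<in> ?S"
      by (rule range_eqI[of _ _ "\<lambda>j. c j + d j"]) (simp add: c d scaleR_add_left sum.distrib)
  qed
  moreover have "f ` {..<n} \<subseteq> ?S"
  proof (rule image_subsetI)
    fix k assume "k \<in> {..<n}"
    then have "f k = (\<Sum>j<n. (if j = k then 1 else 0) *\<^sub>R f j)"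
      by (simp add: if_distrib[of "\<lambda>a. a *\<^sub>R _"] cong: if_cong)
    then show "f k \<in> ?S" by (rule range_eqI[of _ _ "\<lambda>j. if j = k then 1 else 0"])
  qed
  ultimately have "span (f ` {..<n}) \<subseteq> ?S" by (intro span_minimal)
  then show thesis using assms that by blast
qed

lemma form_eq_inner: "form T u = T \<bullet> rank_one u"
  by (simp add: form_def rank_one_def inner_vec_def)

text \<open>Squared entries are products over the modes, so by distributivity the sum over all
  multi-indices factors into one sum per mode.\<close>

lemma norm_rank_one:
  fixes u :: "'s::finite \<Rightarrow> real ^ 'i::finite"
  shows "norm (rank_one u) = (\<Prod>k\<in>UNIV. norm (u k))"
proof -
  have "(\<Sum>i\<in>UNIV. (\<Prod>k\<in>UNIV. u k $ i k)\<^sup>2) = (\<Sum>i\<in>PiE UNIV (\<lambda>_. UNIV). \<Prod>k\<in>UNIV. (u k $ i k)\<^sup>2)"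
    by (simp add: prod_power_distrib)
  also have "\<dots> = (\<Prod>k\<in>UNIV. \<Sum>a\<in>UNIV. (u k $ a)\<^sup>2)"
    by (subst prod_sum_PiE) simp_all
  finally have "(norm (rank_one u))\<^sup>2 = (\<Prod>k\<in>UNIV. norm (u k))\<^sup>2"
    by (simp add: norm_vec_def L2_set_def rank_one_def sum_nonneg prod_nonneg prod_power_distrib)
  then show ?thesis
    by (simp add: prod_nonneg)
qed

lemma subspace_tensor_space: "subspace (tensor_space I)"
  by (simp add: subspace_def tensor_space_def)

lemma rank_one_in_tensor_space:
  assumes "\<And>k. u k \<in> coord_space (I k)"
  shows "rank_one u \<in> tensor_space I"
  using assms by (fastforce simp: tensor_space_def coord_space_def rank_one_def)

text \<open>The form at \<open>q\<close> is the inner product with \<open>rank_one q\<close>, which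
  lies in the span projected onto. This is what turns greedy increments into values of the
  residual.\<close>

lemma form_Proj:
  assumes "q \<in> Q"
  shows "form (Proj Q T) q = form T q"
  using inner_orth_proj[OF subspace_span span_base[OF imageI[OF assms]]]
  by (simp add: form_eq_inner Proj_def)

lemma form_diff: "form (S - T) u = form S u - form T u"
  by (simp add: form_eq_inner inner_diff_left)

lemma greedy_orderingD:
  assumes "greedy_ordering T P p m" "j < m"
  shows "p (j + 1) \<in> P"
    and "q \<in> P \<Longrightarrow> \<bar>form (T - Proj (p ` {1..j}) T) q\<bar> \<le> \<bar>form (T - Proj (p ` {1..j}) T) (p (j + 1))\<bar>"
  using assms by (auto simp: greedy_ordering_def is_arg_max_linorder form_diff form_Proj)

lemma P_norm_residual_le_proj_value:
  assumes "unit_domain I P" "greedy_ordering T P p m" "j < m"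
  shows "P_norm P (T - Proj (p ` {1..j}) T) \<le> proj_value T p (j + 1)"
  unfolding P_norm_def
proof (rule cSUP_least)
  note greedy = greedy_orderingD[OF assms(2,3)]
  show "P \<noteq> {}" using greedy(1) by blast
  fix q assume "q \<in> P"
  then have "\<bar>form (T - Proj (p ` {1..j}) T) q\<bar> \<le> \<bar>form (T - Proj (p ` {1..j}) T) (p (j + 1))\<bar>"
    by (rule greedy(2))
  \<comment> \<open>The new element belongs to the enlarged set, so at it \<open>T\<close> may be
    replaced by its next projection.\<close>
  also have "\<dots> = \<bar>(Proj (p ` {1..j + 1}) T - Proj (p ` {1..j}) T) \<bullet> rank_one (p (j + 1))\<bar>"
    by (simp add: form_diff form_Proj flip: form_eq_inner)
  also have "\<dots> \<le> proj_value T p (j + 1) * norm (rank_one (p (j + 1)))"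
    unfolding proj_value_def add_diff_cancel_right' by (rule Cauchy_Schwarz_ineq2)
  also have "norm (rank_one (p (j + 1))) = 1"
    using assms(1) greedy(1) by (simp add: norm_rank_one unit_domain_def)
  finally show "\<bar>form (T - Proj (p ` {1..j}) T) q\<bar> \<le> proj_value T p (j + 1)" by simp
qed

text \<open>Pythagoras makes the sum telescope, starting from the projection onto the zero
  space.\<close>

lemma sum_proj_value_power2: "(\<Sum>j=1..m. (proj_value T p j)\<^sup>2) = (norm (Proj (p ` {1..m}) T))\<^sup>2"
proof (induction m)
  case 0
  have "Proj {} T = 0"
    using orth_proj_mem[OF subspace_span, of "{}" T] by (simp add: Proj_def)
  then show ?case by simp
next
  case (Suc m)
  have "span (rank_one ` p ` {1..m}) \<subseteq> span (rank_one ` p ` {1..Suc m})"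
    by (intro span_mono image_mono) auto
  from norm_orth_proj_diff[OF subspace_span subspace_span this, of T]
  show ?case using Suc by (simp add: proj_value_def Proj_def)
qed

lemma L2_set_proj_value_le: "L2_set (proj_value T p) {1..m} \<le> norm T"
  unfolding L2_set_def sum_proj_value_power2 Proj_def
  by (simp add: norm_orth_proj_le)

lemma exists_le_L2_set_mean:
  fixes f :: "'a \<Rightarrow> real"
  assumes "finite A" "A \<noteq> {}"
  shows "\<exists>a\<in>A. f a \<le> L2_set f A / sqrt (real (card A))"
proof (rule ccontr)
  assume "\<not> ?thesis"
  then have gt: "L2_set f A / sqrt (real (card A)) < f a" if "a \<in> A" for a
    using that by force
  have "card A > 0" using assms by (simp add: card_gt_0_iff)
  \<comment> \<open>Squaring keeps the strict inequality because the left side is nonnegative,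
    whatever the sign of \<open>f\<close>.\<close>
  have "(\<Sum>a\<in>A. (L2_set f A / sqrt (real (card A)))\<^sup>2) < (\<Sum>a\<in>A. (f a)\<^sup>2)"
    using gt assms by (intro sum_strict_mono power_strict_mono) (auto simp: L2_set_nonneg)
  also have "\<dots> = (L2_set f A)\<^sup>2"
    by (simp add: L2_set_def sum_nonneg)
  finally show False using \<open>card A > 0\<close> by (simp add: power_divide)
qed

theorem theorem18:
  fixes I :: "'s::finite \<Rightarrow> 'i::finite set"
    and T :: "('s, 'i) tensor"
    and P :: "('s \<Rightarrow> real ^ 'i) set"
    and p :: "nat \<Rightarrow> 's \<Rightarrow> real ^ 'i"
    and r :: nat
  assumes "T \<in> tensor_space I"
    and "unit_domain I P"
    and "greedy_ordering T P p (r + 1)"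
  shows "\<exists>T'\<in>tensor_space I.
           (\<exists>c u. (\<forall>j<r. u j \<in> P) \<and> T' = (\<Sum>j<r. c j *\<^sub>R rank_one (u j))) \<and>
           P_norm P (T - T') \<le> L2_set (proj_value T p) {1..r + 1} / sqrt (real (r + 1)) \<and>
           L2_set (proj_value T p) {1..r + 1} / sqrt (real (r + 1)) \<le> norm T / sqrt (real (r + 1))"
proof -
  obtain k where k: "k \<in> {1..r + 1}"
      "proj_value T p k \<le> L2_set (proj_value T p) {1..r + 1} / sqrt (real (r + 1))"
    using exists_le_L2_set_mean[of "{1..r + 1}" "proj_value T p"] by auto
  \<comment> \<open>The value with index \<open>k\<close> bounds the residual left after
    \<open>k - 1\<close> steps, and \<open>k \<le> r + 1\<close> keeps that number at most
    \<open>r\<close>.\<close>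
  define j where "j = k - 1"
  have j: "j \<le> r" "k = j + 1" using k(1) by (auto simp: j_def)
  define T' where "T' = Proj (p ` {1..j}) T"
  have u: "p (i + 1) \<in> P" if "i < r" for i
    using greedy_orderingD(1)[OF assms(3)] that by simp
  \<comment> \<open>If \<open>j < r\<close>, the span is enlarged by later greedy elements, still in
    \<open>P\<close>, to reach exactly \<open>r\<close> terms.\<close>
  have "{1..j} \<subseteq> (\<lambda>i. i + 1) ` {..<r}"
    using j(1) by (simp add: image_Suc_lessThan)
  then have "rank_one ` p ` {1..j} \<subseteq> (\<lambda>i. rank_one (p (i + 1))) ` {..<r}" by fastforce
  then have "T' \<in> span ((\<lambda>i. rank_one (p (i + 1))) ` {..<r})"
    using orth_proj_mem[OF subspace_span] span_mono unfolding T'_def Proj_def by blast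
  then obtain c where c: "T' = (\<Sum>i<r. c i *\<^sub>R rank_one (p (i + 1)))"
    by (rule span_image_lessThan)
  show ?thesis
  proof (intro bexI conjI exI)
    show "\<forall>i<r. p (i + 1) \<in> P" using u by blast
    show "T' = (\<Sum>i<r. c i *\<^sub>R rank_one (p (i + 1)))" by (rule c)
    have "rank_one (p (i + 1)) \<in> tensor_space I" if "i < r" for i
      using u[OF that] assms(2) by (intro rank_one_in_tensor_space) (simp add: unit_domain_def)
    then show "T' \<in> tensor_space I"
      unfolding c by (intro subspace_sum subspace_scale subspace_tensor_space) simp
    have "P_norm P (T - T') \<le> proj_value T p k"
      using P_norm_residual_le_proj_value[OF assms(2,3), of j] j unfolding T'_def by simp
    with k(2) show "P_norm P (T - T') \<le> L2_set (proj_value T p) {1..r + 1} / sqrt (real (r + 1))"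
      by linarith
    show "L2_set (proj_value T p) {1..r + 1} / sqrt (real (r + 1)) \<le> norm T / sqrt (real (r + 1))"
      by (intro divide_right_mono L2_set_proj_value_le) simp
  qed
qed

end
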